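(* The lightlike geodesic torsion $\kappa_G$ is an extrinsic invariant. That is, it is not determined by the first fundamental form: there exist mixed type surfaces $f,\tilde f:U\to\mathbf{L}^3$, having lightlike points of the first kind, with the same first fundamental form on $U$, whose lightlike geodesic torsions do not coincide along the set of lightlike points.
   Context: $\mathbf{L}^3$ is $\mathbb R^3$ with $\langle x,y\rangle=x_1y_1+x_2y_2-x_3y_3$; $|x|:=\sqrt{|\langle x,x\rangle|}$; non-zero $x$ is spacelike/timelike/lightlike if $\langle x,x\rangle$ is $>0$/$<0$/$=0$. A surface is an embedding $f:\Sigma\to\mathbf{L}^3$ of a connected smooth 2-manifold; its first fundamental form is $ds^2=f^*\langle\cdot,\cdot\rangle$; a point is spacelike/timelike/lightlike if $ds^2$ is positive definite/indefinite/degenerate there; $LD$ is the lightlike set; $f$ is of mixed type if all three occur. In coordinates with $ds^2=E\,du^2+2F\,du\,dv+G\,dv^2$, a lightlike point $p$ is non-degenerate if $d(EG-F^2)(p)\neq0$; then $LD$ is near $p$ the image of a regular curve $c$, $c(0)=p$ (characteristic curve), and $p$ is of the first kind if $\hat c'(0)$ is spacelike, $\hat c=f\circ c$. A null vector field $\eta$ is a vector field near $p$ with $\eta\neq0$, $ds^2(\eta,\cdot)=0$ at points of $LD$. For $p=c(0)$ of the first kind let $\boldsymbol e=\hat c'/|\hat c'|$, $L(t)=df(\eta_{c(t)})$, $N(t)$ the unique vector field along $\hat c$ with $\langle N,N\rangle=\langle N,\boldsymbol e\rangle=0$, $\langle N,L\rangle=1$, and $\beta(t)=(\eta\langle df(\eta),df(\eta)\rangle)(c(t))$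 (derivative in direction $\eta$, non-zero). The lightlike geodesic torsion is $$\kappa_G(p)=\frac1{|\hat c'(0)|}\Big(\langle L(0),N'(0)\rangle+\frac{\beta'(0)}{3\beta(0)}\Big),$$ independent of choices. An invariant of mixed type surfaces is called extrinsic if there exists a mixed type surface $\tilde f$ with the same first fundamental form as $f$, but on which the invariant does not coincide with that of $f$. *)

theory Defs
  imports "HOL-Analysis.Analysis"
begin

section \<open>Lorentz-Minkowski 3-space\<close>

definition lorentz :: "real^3 \<Rightarrow> real^3 \<Rightarrow> real" where
  "lorentz x y = x$1 * y$1 + x$2 * y$2 - x$3 * y$3"

definition lnorm :: "real^3 \<Rightarrow> real" where
  "lnorm x = sqrt \<bar>lorentz x x\<bar>"

definition spacelike :: "real^3 \<Rightarrow> bool" where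
  "spacelike x \<longleftrightarrow> x \<noteq> 0 \<and> lorentz x x > 0"

section \<open>Smooth maps\<close>

text \<open>Intended for open \<open>S\<close> and finite-dimensional domains, where this is the usual \<open>C\<^sup>k\<close>:
  all directional derivatives up to order \<open>k\<close> exist and are continuous.\<close>

primrec Ck_on :: "nat \<Rightarrow> 'a::euclidean_space set \<Rightarrow> ('a \<Rightarrow> 'b::euclidean_space) \<Rightarrow> bool" where
  "Ck_on 0 S f \<longleftrightarrow> continuous_on S f"
| "Ck_on (Suc k) S f \<longleftrightarrow>
     (\<forall>x\<in>S. f differentiable (at x)) \<and> (\<forall>v. Ck_on k S (\<lambda>x. frechet_derivative f (at x) v))"

definition smooth_on :: "'a::euclidean_space set \<Rightarrow> ('a \<Rightarrow> 'b::euclidean_space) \<Rightarrow> bool" where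
  "smooth_on S f \<longleftrightarrow> (\<forall>k. Ck_on k S f)"

section \<open>Mixed type surfaces parametrised by a plane domain\<close>

abbreviation df :: "(real^2 \<Rightarrow> real^3) \<Rightarrow> real^2 \<Rightarrow> real^2 \<Rightarrow> real^3" where
  "df f p \<equiv> frechet_derivative f (at p)"

definition surface :: "(real^2) set \<Rightarrow> (real^2 \<Rightarrow> real^3) \<Rightarrow> bool" where
  "surface U f \<longleftrightarrow> open U \<and> connected U \<and> U \<noteq> {} \<and> smooth_on U f \<and>
     (\<forall>p\<in>U. inj (df f p)) \<and> (\<exists>g. homeomorphism U (f ` U) f g)"

definition fff :: "(real^2 \<Rightarrow> real^3) \<Rightarrow> real^2 \<Rightarrow> real^2 \<Rightarrow> real^2 \<Rightarrow> real" where
  "fff f p v w = lorentz (df f p v) (df f p w)"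

definition spacelike_point :: "(real^2 \<Rightarrow> real^3) \<Rightarrow> real^2 \<Rightarrow> bool" where
  "spacelike_point f p \<longleftrightarrow> (\<forall>v. v \<noteq> 0 \<longrightarrow> fff f p v v > 0)"

definition timelike_point :: "(real^2 \<Rightarrow> real^3) \<Rightarrow> real^2 \<Rightarrow> bool" where
  "timelike_point f p \<longleftrightarrow> (\<exists>v. fff f p v v > 0) \<and> (\<exists>v. fff f p v v < 0)"

definition lightlike_point :: "(real^2 \<Rightarrow> real^3) \<Rightarrow> real^2 \<Rightarrow> bool" where
  "lightlike_point f p \<longleftrightarrow> (\<exists>v. v \<noteq> 0 \<and> (\<forall>w. fff f p v w = 0))"

definition LD :: "(real^2) set \<Rightarrow> (real^2 \<Rightarrow> real^3) \<Rightarrow> (real^2) set" where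
  "LD U f = {p \<in> U. lightlike_point f p}"

definition mixed_type_surface :: "(real^2) set \<Rightarrow> (real^2 \<Rightarrow> real^3) \<Rightarrow> bool" where
  "mixed_type_surface U f \<longleftrightarrow> surface U f \<and>
     (\<exists>p\<in>U. spacelike_point f p) \<and> (\<exists>p\<in>U. timelike_point f p) \<and> (\<exists>p\<in>U. lightlike_point f p)"

definition same_fff :: "(real^2) set \<Rightarrow> (real^2 \<Rightarrow> real^3) \<Rightarrow> (real^2 \<Rightarrow> real^3) \<Rightarrow> bool" where
  "same_fff U f g \<longleftrightarrow> (\<forall>p\<in>U. \<forall>v w. fff f p v w = fff g p v w)"

section \<open>Lightlike points of the first kind\<close>

definition fff_det :: "(real^2 \<Rightarrow> real^3) \<Rightarrow> real^2 \<Rightarrow> real" where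
  "fff_det f p =
     (let E = fff f p (axis 1 1) (axis 1 1);
          F = fff f p (axis 1 1) (axis 2 1);
          G = fff f p (axis 2 1) (axis 2 1)
      in E * G - F\<^sup>2)"

definition nondegenerate_lightlike :: "(real^2) set \<Rightarrow> (real^2 \<Rightarrow> real^3) \<Rightarrow> real^2 \<Rightarrow> bool" where
  "nondegenerate_lightlike U f p \<longleftrightarrow>
     p \<in> LD U f \<and> frechet_derivative (fff_det f) (at p) \<noteq> (\<lambda>_. 0)"

definition characteristic_curve ::
    "(real^2) set \<Rightarrow> (real^2 \<Rightarrow> real^3) \<Rightarrow> real^2 \<Rightarrow> (real \<Rightarrow> real^2) \<Rightarrow> bool" where
  "characteristic_curve U f p c \<longleftrightarrow> c 0 = p \<and>
     (\<exists>\<delta>>0. smooth_on {-\<delta><..<\<delta>} c \<and>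
        (\<forall>t\<in>{-\<delta><..<\<delta>}. vector_derivative c (at t) \<noteq> 0) \<and>
        (\<exists>V. open V \<and> p \<in> V \<and> V \<subseteq> U \<and> LD U f \<inter> V = c ` {-\<delta><..<\<delta>}))"

text \<open>\<open>chat_deriv f c\<close> is the velocity of the space curve \<open>f \<circ> c\<close>.\<close>

definition chat_deriv :: "(real^2 \<Rightarrow> real^3) \<Rightarrow> (real \<Rightarrow> real^2) \<Rightarrow> real \<Rightarrow> real^3" where
  "chat_deriv f c t = vector_derivative (f \<circ> c) (at t)"

definition first_kind :: "(real^2) set \<Rightarrow> (real^2 \<Rightarrow> real^3) \<Rightarrow> real^2 \<Rightarrow> bool" where
  "first_kind U f p \<longleftrightarrow> nondegenerate_lightlike U f p \<and>
     (\<exists>c. characteristic_curve U f p c \<and> spacelike (chat_deriv f c 0))"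

definition null_vector_field ::
    "(real^2) set \<Rightarrow> (real^2 \<Rightarrow> real^3) \<Rightarrow> real^2 \<Rightarrow> (real^2 \<Rightarrow> real^2) \<Rightarrow> bool" where
  "null_vector_field U f p \<eta> \<longleftrightarrow>
     (\<exists>V. open V \<and> p \<in> V \<and> V \<subseteq> U \<and> smooth_on V \<eta> \<and>
        (\<forall>q \<in> LD U f \<inter> V. \<eta> q \<noteq> 0 \<and> (\<forall>w. fff f q (\<eta> q) w = 0)))"

section \<open>The lightlike geodesic torsion\<close>

definition e_field :: "(real^2 \<Rightarrow> real^3) \<Rightarrow> (real \<Rightarrow> real^2) \<Rightarrow> real \<Rightarrow> real^3" where
  "e_field f c t = chat_deriv f c t /\<^sub>R lnorm (chat_deriv f c t)"

definition L_field ::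
    "(real^2 \<Rightarrow> real^3) \<Rightarrow> (real \<Rightarrow> real^2) \<Rightarrow> (real^2 \<Rightarrow> real^2) \<Rightarrow> real \<Rightarrow> real^3" where
  "L_field f c \<eta> t = df f (c t) (\<eta> (c t))"

definition N_field ::
    "(real^2 \<Rightarrow> real^3) \<Rightarrow> (real \<Rightarrow> real^2) \<Rightarrow> (real^2 \<Rightarrow> real^2) \<Rightarrow> real \<Rightarrow> real^3" where
  "N_field f c \<eta> t =
     (THE n. lorentz n n = 0 \<and> lorentz n (e_field f c t) = 0 \<and> lorentz n (L_field f c \<eta> t) = 1)"

definition \<beta>_fun ::
    "(real^2 \<Rightarrow> real^3) \<Rightarrow> (real \<Rightarrow> real^2) \<Rightarrow> (real^2 \<Rightarrow> real^2) \<Rightarrow> real \<Rightarrow> real" where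
  "\<beta>_fun f c \<eta> t = frechet_derivative (\<lambda>q. fff f q (\<eta> q) (\<eta> q)) (at (c t)) (\<eta> (c t))"

definition torsion_expr ::
    "(real^2 \<Rightarrow> real^3) \<Rightarrow> (real \<Rightarrow> real^2) \<Rightarrow> (real^2 \<Rightarrow> real^2) \<Rightarrow> real" where
  "torsion_expr f c \<eta> =
     (lorentz (L_field f c \<eta> 0) (vector_derivative (N_field f c \<eta>) (at 0))
        + deriv (\<beta>_fun f c \<eta>) 0 / (3 * \<beta>_fun f c \<eta> 0))
     / lnorm (chat_deriv f c 0)"

text \<open>\<open>\<kappa>\<close> is a value of the lightlike geodesic torsion of \<open>f\<close> at \<open>p\<close>, computed with some admissible
  \<open>c\<close> and \<open>\<eta>\<close>. This is a relation because the value does not depend on \<open>\<eta>\<close> or on the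
  parametrisation of \<open>c\<close>, but changes sign when \<open>c\<close> is traversed backwards.\<close>

definition has_lightlike_geodesic_torsion ::
    "(real^2) set \<Rightarrow> (real^2 \<Rightarrow> real^3) \<Rightarrow> real^2 \<Rightarrow> real \<Rightarrow> bool" where
  "has_lightlike_geodesic_torsion U f p \<kappa> \<longleftrightarrow> first_kind U f p \<and>
     (\<exists>c \<eta>. characteristic_curve U f p c \<and> null_vector_field U f p \<eta> \<and> \<kappa> = torsion_expr f c \<eta>)"

text \<open>The torsions of \<open>f\<close> and \<open>g\<close> differ at \<open>p\<close>: both are defined there, and no choices of
  characteristic curves (in particular, of their orientations) and null vector fields,
  made independently for \<open>f\<close> and \<open>g\<close>, give equal values.\<close>

definition lightlike_geodesic_torsions_differ_at ::
    "(real^2) set \<Rightarrow> (real^2 \<Rightarrow> real^3) \<Rightarrow> (real^2 \<Rightarrow> real^3) \<Rightarrow> real^2 \<Rightarrow> bool" where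
  "lightlike_geodesic_torsions_differ_at U f g p \<longleftrightarrow>
     (\<exists>\<kappa>. has_lightlike_geodesic_torsion U f p \<kappa>) \<and>
     (\<exists>\<kappa>. has_lightlike_geodesic_torsion U g p \<kappa>) \<and>
     (\<forall>\<kappa> \<mu>. has_lightlike_geodesic_torsion U f p \<kappa> \<longrightarrow>
            has_lightlike_geodesic_torsion U g p \<mu> \<longrightarrow> \<kappa> \<noteq> \<mu>)"

end

theory Submission
  imports Defs
begin

text \<open>
  A metric that is invariant under a one-parameter group can be realised by surfaces that are
  swept out by different groups of motions, as in Bour's theorem on helicoidal surfaces. In
  \<open>\<^bold>L\<^sup>3\<close> this produces polynomial surfaces if the group contains the rotation about a lightlike
  axis. In null coordinates, in which the form is \<open>y\<^sup>2 - 2 a b\<close>, that rotation is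
  \<open>(a, y, b) \<mapsto> (a, y + t a, b + t y + t\<^sup>2 a / 2)\<close>. The orbits of the curve
  \<open>u \<mapsto> (u, 0, u\<^sup>5/10 - u\<^sup>3/6)\<close> form a surface of revolution \<open>rotational\<close>. Combining the rotation
  with the translation along the \<open>a\<close> direction gives a cubic screw motion, whose orbits of
  \<open>u \<mapsto> (0, - u\<^sup>2/2, u\<^sup>4/4)\<close> form a surface \<open>screw\<close>. After the shift \<open>s = t + u\<^sup>2/2\<close> of the
  orbit parameter, which removes the mixed term, both have the metric
  \<open>u\<^sup>2 (1 - u\<^sup>2) du\<^sup>2 + u\<^sup>2 dt\<^sup>2\<close> on the half plane \<open>u > 0\<close>. It is positive definite for \<open>u < 1\<close>,
  indefinite for \<open>u > 1\<close>, and degenerate in the direction \<open>\<partial>\<^sub>u\<close> on the line \<open>u = 1\<close>, whose image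
  is spacelike. So the points of this line are lightlike points of the first kind.

  For every surface with this metric, \<open>revolution_torsion\<close> computes the torsion for arbitrary
  choices of the characteristic curve and the null field: up to a sign it is
  \<open>\<langle>f\<^sub>u, n'\<rangle>\<close>, where \<open>n(t)\<close> is the null field along the line with \<open>\<langle>n, f\<^sub>t\<rangle> = 0\<close> and
  \<open>\<langle>n, f\<^sub>u\<rangle> = 1\<close>. For \<open>rotational\<close> the field \<open>n\<close> is the constant direction of the axis, so the
  torsion is \<open>0\<close>; for \<open>screw\<close> it is \<open>\<plusminus>1\<close>. Since \<open>0\<close> differs from both \<open>1\<close> and \<open>-1\<close>, the
  orientation of the characteristic curves does not matter.
\<close>

section \<open>Smoothness of polynomial maps\<close>

text \<open>Directional derivatives of polynomials are again polynomials, so by induction on the order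
  polynomial maps have continuous derivatives of every order.\<close>

lemma real_polynomial_function_derivative:
  fixes p :: "'a::euclidean_space \<Rightarrow> real"
  assumes "real_polynomial_function p"
  shows "\<exists>p'. (\<forall>x. (p has_derivative p' x) (at x)) \<and>
              (\<forall>v. real_polynomial_function (\<lambda>x. p' x v))"
  using assms
proof induction
  case (linear f)
  then show ?case
    by (intro exI[of _ "\<lambda>_. f"]) (auto intro: bounded_linear_imp_has_derivative)
next
  case (const c)
  show ?case
    by (intro exI[of _ "\<lambda>_ _. 0"]) auto
next
  case (add f g)
  then obtain f' g' where
    "\<forall>x. (f has_derivative f' x) (at x)" "\<forall>v. real_polynomial_function (\<lambda>x. f' x v)"
    "\<forall>x. (g has_derivative g' x) (at x)" "\<forall>v. real_polynomial_function (\<lambda>x. g' x v)"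
    by blast
  then show ?case
    by (intro exI[of _ "\<lambda>x v. f' x v + g' x v"]) (auto intro: has_derivative_add)
next
  case (mult f g)
  then obtain f' g' where
    "\<forall>x. (f has_derivative f' x) (at x)" "\<forall>v. real_polynomial_function (\<lambda>x. f' x v)"
    "\<forall>x. (g has_derivative g' x) (at x)" "\<forall>v. real_polynomial_function (\<lambda>x. g' x v)"
    by blast
  with mult.hyps show ?case
    by (intro exI[of _ "\<lambda>x v. f x * g' x v + f' x v * g x"] conjI allI has_derivative_mult
        real_polynomial_function.intros(3,4)) auto
qed

lemma polynomial_function_derivative:
  fixes p :: "'a::euclidean_space \<Rightarrow> 'b::euclidean_space"
  assumes "polynomial_function p"
  shows "p differentiable (at x)" "polynomial_function (\<lambda>x. frechet_derivative p (at x) v)"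
proof -
  have "\<forall>i\<in>Basis. \<exists>p'. (\<forall>x. ((\<lambda>x. p x \<bullet> i) has_derivative p' x) (at x)) \<and>
              (\<forall>v. real_polynomial_function (\<lambda>x. p' x v))"
    using assms real_polynomial_function_derivative polynomial_function_iff_Basis_inner by blast
  then obtain D where D: "\<And>i x. i \<in> Basis \<Longrightarrow> ((\<lambda>x. p x \<bullet> i) has_derivative D i x) (at x)"
      "\<And>i v. i \<in> Basis \<Longrightarrow> real_polynomial_function (\<lambda>x. D i x v)"
    by metis
  have p: "(p has_derivative (\<lambda>v. \<Sum>i\<in>Basis. D i x v *\<^sub>R i)) (at x)" for x
    using D(1) by (subst has_derivative_componentwise_within) simp
  show "p differentiable (at x)"
    using p by (rule differentiableI)
  have "frechet_derivative p (at x) v = (\<Sum>i\<in>Basis. D i x v *\<^sub>R i)" for x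
    by (simp flip: frechet_derivative_at[OF p])
  moreover have "polynomial_function (\<lambda>x. \<Sum>i\<in>Basis. D i x v *\<^sub>R i)"
    using D(2) by (intro polynomial_function_sum polynomial_function_mult polynomial_function_const)
      (auto simp: real_polynomial_function_eq)
  ultimately show "polynomial_function (\<lambda>x. frechet_derivative p (at x) v)"
    by simp
qed

lemma smooth_on_polynomial_function:
  fixes p :: "'a::euclidean_space \<Rightarrow> 'b::euclidean_space"
  assumes "polynomial_function p"
  shows "smooth_on S p"
proof -
  have "Ck_on k S p" for k
    using assms
  proof (induction k arbitrary: p)
    case 0
    then show ?case
      by (simp add: continuous_on_polymonial_function)
  next
    case (Suc k)
    then show ?case
      by (simp add: polynomial_function_derivative)
  qed
  then show ?thesis
    by (simp add: smooth_on_def)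
qed

lemma smooth_on_imp_differentiable:
  "smooth_on S f \<Longrightarrow> x \<in> S \<Longrightarrow> f differentiable (at x)"
  unfolding smooth_on_def by (metis Ck_on.simps(2))

section \<open>Null coordinates\<close>

text \<open>The coordinates \<open>a = x\<^sub>2 + x\<^sub>3\<close>, \<open>y = x\<^sub>1\<close>, \<open>b = (x\<^sub>3 - x\<^sub>2) / 2\<close>, in which the
  rotations about a lightlike axis are polynomial.\<close>

definition null_vec :: "real \<Rightarrow> real \<Rightarrow> real \<Rightarrow> real^3" where
  "null_vec a y b = y *\<^sub>R axis 1 1 + (a / 2 - b) *\<^sub>R axis 2 1 + (a / 2 + b) *\<^sub>R axis 3 1"

definition pt :: "real \<Rightarrow> real \<Rightarrow> real^2" where
  "pt u t = u *\<^sub>R axis 1 1 + t *\<^sub>R axis 2 1"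

lemma pt_nth [simp]: "pt u t $ 1 = u" "pt u t $ 2 = t"
  by (auto simp: pt_def axis_def)

lemma pt_collapse: "pt (q $ 1) (q $ 2) = q"
  by (simp add: vec_eq_iff forall_2)

lemma null_vec_nth [simp]:
  "null_vec a y b $ 1 = y" "null_vec a y b $ 2 = a / 2 - b" "null_vec a y b $ 3 = a / 2 + b"
  by (auto simp: null_vec_def axis_def)

lemma lorentz_null_vec [simp]:
  "lorentz (null_vec a y b) (null_vec a' y' b') = y * y' - a * b' - a' * b"
  by (simp add: lorentz_def field_simps)

lemma null_vec_linear:
  "null_vec a y b + null_vec a' y' b' = null_vec (a + a') (y + y') (b + b')"
  "r *\<^sub>R null_vec a y b = null_vec (r * a) (r * y) (r * b)"
  by (simp_all add: vec_eq_iff forall_3 field_simps)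

lemma has_derivative_null_vec [derivative_intros]:
  assumes "(a has_derivative a') F" "(y has_derivative y') F" "(b has_derivative b') F"
  shows "((\<lambda>x. null_vec (a x) (y x) (b x)) has_derivative (\<lambda>v. null_vec (a' v) (y' v) (b' v))) F"
  unfolding null_vec_def
  by (intro derivative_intros bounded_linear.has_derivative[OF bounded_linear_divide] assms)

lemma polynomial_function_null_vec:
  assumes "real_polynomial_function a" "real_polynomial_function y" "real_polynomial_function b"
  shows "polynomial_function (\<lambda>x. null_vec (a x) (y x) (b x))"
  unfolding null_vec_def using assms
  by (intro polynomial_function_add polynomial_function_mult polynomial_function_const)
    (auto simp flip: real_polynomial_function_eq)

lemma has_derivative_vec_nth [derivative_intros]:
  "(f has_derivative f') F \<Longrightarrow> ((\<lambda>x. f x $ i) has_derivative (\<lambda>v. f' v $ i)) F"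
  by (rule bounded_linear.has_derivative[OF bounded_linear_vec_nth])

section \<open>Uniqueness of the null transversal\<close>

lemma lorentz_bilinear:
  "lorentz (x + x') y = lorentz x y + lorentz x' y" "lorentz (r *\<^sub>R x) y = r * lorentz x y"
  "lorentz x (y + y') = lorentz x y + lorentz x y'" "lorentz x (r *\<^sub>R y) = r * lorentz x y"
  "lorentz (x - x') y = lorentz x y - lorentz x' y" "lorentz x (y - y') = lorentz x y - lorentz x y'"
  by (simp_all add: lorentz_def algebra_simps)

lemma lorentz_commute: "lorentz x y = lorentz y x"
  by (simp add: lorentz_def algebra_simps)

text \<open>The Gram matrix of the frame \<open>e\<close>, \<open>l\<close>, \<open>n\<close> has determinant \<open>-1\<close>. It equals
  \<open>- d\<^sup>2\<close> for the Euclidean determinant \<open>d\<close> of the frame, which is therefore non-zero.\<close>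

lemma lorentz_orthogonal_frame_eq_0:
  assumes ee: "lorentz e e = 1" and el: "lorentz e l = 0" and en: "lorentz e n = 0"
    and ll: "lorentz l l = 0" and nn: "lorentz n n = 0" and ln: "lorentz l n = 1"
    and x: "lorentz x e = 0" "lorentz x l = 0" "lorentz x n = 0"
  shows "x = 0"
proof -
  define d where "d = e$1 * (l$2 * n$3 - l$3 * n$2) - e$2 * (l$1 * n$3 - l$3 * n$1)
                    + e$3 * (l$1 * n$2 - l$2 * n$1)"
  have "- d\<^sup>2 = lorentz e e * (lorentz l l * lorentz n n - (lorentz l n)\<^sup>2)
      - lorentz e l * (lorentz e l * lorentz n n - lorentz l n * lorentz e n)
      + lorentz e n * (lorentz e l * lorentz l n - lorentz l l * lorentz e n)"
    unfolding d_def lorentz_def by algebra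
  then have "d \<noteq> 0"
    using ee el en ll nn ln by auto
  \<comment> \<open>Cramer's rule for the homogeneous linear system given by the orthogonality to the frame\<close>
  moreover have "d * x$1 = 0" "d * x$2 = 0" "d * x$3 = 0"
    using x unfolding d_def lorentz_def by algebra+
  ultimately show ?thesis
    by (simp add: vec_eq_iff forall_3)
qed

text \<open>A vector with the same products with \<open>e\<close> and \<open>l\<close> as \<open>n\<close> has the form \<open>n + r l\<close>,
  and \<open>\<langle>n + r l, n + r l\<rangle> = 2 r\<close>. This determines the field \<open>N\<close> in the definition of the
  torsion.\<close>

lemma lorentz_null_transversal_unique:
  assumes ee: "lorentz e e = 1" and el: "lorentz e l = 0" and en: "lorentz e n = 0"
    and ll: "lorentz l l = 0" and nn: "lorentz n n = 0" and ln: "lorentz l n = 1"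
    and m: "lorentz m m = 0" "lorentz m e = 0" "lorentz m l = 1"
  shows "m = n"
proof -
  define x where "x = m - n - lorentz m n *\<^sub>R l"
  have "lorentz x e = 0" "lorentz x l = 0" "lorentz x n = 0"
    using assms lorentz_commute[of n e] lorentz_commute[of n l] lorentz_commute[of l e]
    unfolding x_def by (simp_all add: lorentz_bilinear)
  then have "x = 0"
    using lorentz_orthogonal_frame_eq_0 ee el en ll nn ln by blast
  then have mn: "m = n + lorentz m n *\<^sub>R l"
    by (simp add: x_def algebra_simps)
  have "lorentz m m = lorentz (n + lorentz m n *\<^sub>R l) (n + lorentz m n *\<^sub>R l)"
    using mn by simp
  then have "0 = 2 * lorentz m n"
    using m nn ll ln by (simp add: lorentz_bilinear lorentz_commute[of n l])
  with mn show ?thesis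
    by simp
qed


section \<open>A rotationally invariant metric of mixed type\<close>

definition half_plane :: "(real^2) set" where
  "half_plane = {q. q $ 1 > 0}"

text \<open>With \<open>u = q $ 1\<close> and \<open>t = q $ 2\<close> the metric is
  \<open>(u\<^sup>2 - u\<^sup>4) du\<^sup>2 + u\<^sup>2 dt\<^sup>2\<close>. Without differentiability the first fundamental form would be
  built from an arbitrary value of \<open>frechet_derivative\<close>.\<close>

definition revolution_metric :: "(real^2 \<Rightarrow> real^3) \<Rightarrow> bool" where
  "revolution_metric h \<longleftrightarrow> (\<forall>q\<in>half_plane. h differentiable (at q) \<and>
     (\<forall>v w. fff h q v w = ((q $ 1)\<^sup>2 - (q $ 1)^4) * (v $ 1 * w $ 1) + (q $ 1)\<^sup>2 * (v $ 2 * w $ 2)))"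

lemma open_half_plane: "open half_plane"
  unfolding half_plane_def by (intro open_Collect_less continuous_intros)

lemma connected_half_plane: "connected half_plane"
proof -
  have "half_plane = {q. axis 1 1 \<bullet> q > 0}"
    by (simp add: half_plane_def inner_axis inner_commute)
  then have "convex half_plane"
    using convex_halfspace_gt[of 0 "axis 1 (1::real) :: real^2"] by (simp only:)
  then show ?thesis
    by (rule convex_connected)
qed

lemma in_half_plane [simp]: "pt u t \<in> half_plane \<longleftrightarrow> u > 0"
  by (simp add: half_plane_def)

lemma axis_2_nth [simp]: "(axis 1 1 :: real^2) $ 1 = 1" "(axis 1 1 :: real^2) $ 2 = 0"
   "(axis 2 1 :: real^2) $ 1 = 0" "(axis 2 1 :: real^2) $ 2 = 1"
  by (auto simp: axis_def)

lemma vec_2_nonzero_iff: "v \<noteq> (0 :: real^2) \<longleftrightarrow> v $ 1 \<noteq> 0 \<or> v $ 2 \<noteq> 0"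
  by (auto simp: vec_eq_iff forall_2)

lemma square_minus_fourth_power: "u\<^sup>2 - u^4 = u\<^sup>2 * (1 - u) * (1 + u)" for u :: real
  by algebra

context
  fixes h :: "real^2 \<Rightarrow> real^3"
  assumes M: "revolution_metric h"
begin

lemma revolution_fff:
  "q \<in> half_plane \<Longrightarrow>
   fff h q v w = ((q $ 1)\<^sup>2 - (q $ 1)^4) * (v $ 1 * w $ 1) + (q $ 1)\<^sup>2 * (v $ 2 * w $ 2)"
  using M by (simp add: revolution_metric_def)

lemma revolution_differentiable: "q \<in> half_plane \<Longrightarrow> h differentiable (at q)"
  using M by (simp add: revolution_metric_def)

text \<open>On the line \<open>u = 1\<close> the metric is \<open>dt\<^sup>2\<close>.\<close>

lemma revolution_null_iff:
  assumes "q $ 1 = 1"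
  shows "(\<forall>w. fff h q v w = 0) \<longleftrightarrow> v $ 2 = 0"
proof -
  have "fff h q v w = v $ 2 * w $ 2" for w
    using revolution_fff[of q v w] assms by (simp add: half_plane_def)
  then show ?thesis
    by (metis axis_2_nth(4) mult.right_neutral mult_zero_left)
qed

lemma revolution_LD: "LD half_plane h = {q. q $ 1 = 1}"
proof (intro equalityI subsetI)
  fix q assume "q \<in> LD half_plane h"
  then obtain v where q: "q \<in> half_plane" "v \<noteq> 0" "\<And>w. fff h q v w = 0"
    by (auto simp: LD_def lightlike_point_def)
  have pos: "q $ 1 > 0"
    using q(1) by (simp add: half_plane_def)
  have "v $ 2 = 0"
    using q(3)[of "axis 2 1"] pos by (simp add: revolution_fff[OF q(1)])
  then have "v $ 1 \<noteq> 0"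
    using q(2) by (simp add: vec_2_nonzero_iff)
  then have "(q $ 1)\<^sup>2 - (q $ 1)^4 = 0"
    using q(3)[of "axis 1 1"] by (simp add: revolution_fff[OF q(1)])
  then show "q \<in> {q. q $ 1 = 1}"
    using pos by (simp add: square_minus_fourth_power)
next
  fix q :: "real^2" assume "q \<in> {q. q $ 1 = 1}"
  then show "q \<in> LD half_plane h"
    using revolution_null_iff[of q "axis 1 1"]
    by (auto simp: LD_def lightlike_point_def half_plane_def intro!: exI[of _ "axis 1 1"])
qed

lemma revolution_mixed_type:
  assumes "surface half_plane h"
  shows "mixed_type_surface half_plane h"
proof -
  have "spacelike_point h (pt (1/2) 0)"
    unfolding spacelike_point_def
  proof (intro allI impI)
    fix v :: "real^2" assume "v \<noteq> 0"
    then have "(v $ 1)\<^sup>2 > 0 \<or> (v $ 2)\<^sup>2 > 0"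
      by (auto simp: vec_2_nonzero_iff)
    moreover have "fff h (pt (1/2) 0) v v = 3/16 * (v $ 1)\<^sup>2 + 1/4 * (v $ 2)\<^sup>2"
      by (simp add: revolution_fff power2_eq_square power4_eq_xxxx)
    moreover have "(v $ 1)\<^sup>2 \<ge> 0" "(v $ 2)\<^sup>2 \<ge> 0"
      by simp_all
    ultimately show "fff h (pt (1/2) 0) v v > 0"
      by linarith
  qed
  moreover have "timelike_point h (pt 2 0)"
    unfolding timelike_point_def
    by (intro conjI exI[of _ "axis 1 1"] exI[of _ "axis 2 1"]) (simp_all add: revolution_fff)
  moreover have "pt 1 0 \<in> LD half_plane h"
    by (simp add: revolution_LD)
  moreover have "pt (1/2) 0 \<in> half_plane" "pt 2 0 \<in> half_plane"
    by simp_all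
  ultimately show ?thesis
    unfolding mixed_type_surface_def LD_def using assms by blast
qed

text \<open>The determinant of the metric is \<open>u\<^sup>4 - u\<^sup>6\<close>, with derivative \<open>-2\<close> at \<open>u = 1\<close>.\<close>

lemma revolution_nondegenerate: "nondegenerate_lightlike half_plane h (pt 1 0)"
proof -
  have eq: "fff_det h q = (q $ 1)^4 - (q $ 1)^6" if "q \<in> half_plane" for q
  proof -
    have "fff_det h q = ((q $ 1)\<^sup>2 - (q $ 1)^4) * (q $ 1)\<^sup>2"
      using that by (simp add: fff_det_def revolution_fff)
    then show ?thesis
      by algebra
  qed
  have "((\<lambda>q. (q $ 1)^4 - (q $ 1)^6) has_derivative (\<lambda>v. - 2 * v $ 1)) (at (pt 1 0))"
    by (auto intro!: derivative_eq_intros)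
  then have "(fff_det h has_derivative (\<lambda>v. - 2 * v $ 1)) (at (pt 1 0))"
    by (rule has_derivative_transform_within_open[OF _ open_half_plane]) (simp_all add: eq)
  then have "frechet_derivative (fff_det h) (at (pt 1 0)) (axis 1 1) = - 2"
    by (metis frechet_derivative_at axis_2_nth(1) mult.right_neutral)
  then have "frechet_derivative (fff_det h) (at (pt 1 0)) \<noteq> (\<lambda>_. 0)"
    by auto
  then show ?thesis
    by (simp add: nondegenerate_lightlike_def revolution_LD)
qed

lemma chat_deriv_along_line:
  assumes "(\<tau> has_real_derivative d) (at t)" "open S" "t \<in> S"
    "\<And>r. r \<in> S \<Longrightarrow> c r = pt 1 (\<tau> r)"
  shows "chat_deriv h c t = d *\<^sub>R df h (c t) (axis 2 1)"
proof -
  have "((\<lambda>r. pt 1 (\<tau> r)) has_derivative (\<lambda>x. (x * d) *\<^sub>R axis 2 1)) (at t)"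
    using assms(1) unfolding pt_def has_field_derivative_def
    by (auto intro!: derivative_eq_intros)
  then have c: "(c has_derivative (\<lambda>x. (x * d) *\<^sub>R axis 2 1)) (at t)"
    by (rule has_derivative_transform_within_open[OF _ assms(2,3)]) (simp add: assms(4))
  have "(h has_derivative df h (c t)) (at (c t))"
    using assms(3,4) revolution_differentiable[of "c t"] frechet_derivative_works by fastforce
  from diff_chain_at[OF c this] linear_frechet_derivative[of h "at (c t)"]
  have "(h \<circ> c has_derivative (\<lambda>x. x *\<^sub>R d *\<^sub>R df h (c t) (axis 2 1))) (at t)"
    using assms(3,4) revolution_differentiable[of "c t"]
    by (simp add: o_def linear_scale)
  then show ?thesis
    unfolding chat_deriv_def
    by (intro vector_derivative_at) (simp add: has_vector_derivative_def)
qed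

lemma lnorm_along_line: "lnorm (d *\<^sub>R df h (pt 1 s) (axis 2 1)) = \<bar>d\<bar>"
  using revolution_fff[of "pt 1 s" "axis 2 1" "axis 2 1"]
  by (simp add: lnorm_def lorentz_bilinear fff_def real_sqrt_mult)

lemma characteristic_line: "characteristic_curve half_plane h (pt 1 0) (pt 1)"
  unfolding characteristic_curve_def
proof (intro conjI exI[of _ "1::real"] exI[of _ "{q. q $ 1 > 0} \<inter> {q. q $ 2 < 1} \<inter> {q. q $ 2 > -1}"] ballI)
  have "polynomial_function (pt 1)"
    unfolding pt_def[abs_def] by (intro polynomial_function_add polynomial_function_mult) auto
  then show "smooth_on {-1<..<1} (pt 1)"
    by (rule smooth_on_polynomial_function)
  have "(pt 1 has_vector_derivative axis 2 1) (at t)" for t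
    unfolding pt_def[abs_def] by (auto intro!: derivative_eq_intros)
  then show "vector_derivative (pt 1) (at t) \<noteq> 0" for t
    by (metis vector_derivative_at axis_2_nth(4) zero_index zero_neq_one)
  show "LD half_plane h \<inter> ({q. q $ 1 > 0} \<inter> {q. q $ 2 < 1} \<inter> {q. q $ 2 > -1}) = pt 1 ` {-1<..<1}"
    unfolding revolution_LD
  proof (intro equalityI subsetI)
    fix q :: "real^2" assume "q \<in> {q. q $ 1 = 1} \<inter> ({q. q $ 1 > 0} \<inter> {q. q $ 2 < 1} \<inter> {q. q $ 2 > -1})"
    then show "q \<in> pt 1 ` {-1<..<1}"
      using pt_collapse[of q] by (intro image_eqI[of _ _ "q $ 2"]) auto
  qed auto
qed (auto simp: half_plane_def intro!: open_Int open_Collect_less continuous_intros)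

lemma revolution_first_kind: "first_kind half_plane h (pt 1 0)"
proof -
  have c: "chat_deriv h (pt 1) 0 = 1 *\<^sub>R df h (pt 1 0) (axis 2 1)"
    by (rule chat_deriv_along_line[where \<tau> = "\<lambda>t. t" and S = UNIV]) (auto intro!: derivative_eq_intros)
  have "lorentz (chat_deriv h (pt 1) 0) (chat_deriv h (pt 1) 0) = 1"
    unfolding c using revolution_fff[of "pt 1 0" "axis 2 1" "axis 2 1"] by (simp add: fff_def)
  then have "spacelike (chat_deriv h (pt 1) 0)"
    by (auto simp: spacelike_def lorentz_def)
  then show ?thesis
    using revolution_nondegenerate characteristic_line by (auto simp: first_kind_def)
qed

lemma null_field_coordinate: "null_vector_field half_plane h (pt 1 0) (\<lambda>_. axis 1 1)"
  unfolding null_vector_field_def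
  by (intro exI[of _ half_plane])
    (auto simp: open_half_plane revolution_LD revolution_null_iff vec_2_nonzero_iff
      intro!: smooth_on_polynomial_function)

text \<open>Since the lightlike set is the line \<open>u = 1\<close>, a characteristic curve is a regular
  parametrisation of this line, given by its second coordinate.\<close>

lemma characteristic_curve_on_line:
  assumes "characteristic_curve half_plane h (pt 1 0) c"
  obtains \<delta> where "\<delta> > 0" "c 0 = pt 1 0"
    "\<And>t. t \<in> {-\<delta><..<\<delta>} \<Longrightarrow> c t = pt 1 (c t $ 2)"
    "\<And>t. t \<in> {-\<delta><..<\<delta>} \<Longrightarrow> c differentiable (at t)"
    "\<And>t. t \<in> {-\<delta><..<\<delta>} \<Longrightarrow> ((\<lambda>t. c t $ 2) has_real_derivative vector_derivative c (at t) $ 2) (at t)"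
    "\<And>t. t \<in> {-\<delta><..<\<delta>} \<Longrightarrow> vector_derivative c (at t) $ 2 \<noteq> 0"
proof -
  obtain \<delta> V where d: "c 0 = pt 1 0" "\<delta> > 0" "smooth_on {-\<delta><..<\<delta>} c"
    "\<forall>t\<in>{-\<delta><..<\<delta>}. vector_derivative c (at t) \<noteq> 0"
    "LD half_plane h \<inter> V = c ` {-\<delta><..<\<delta>}"
    using assms unfolding characteristic_curve_def by blast
  have c1: "c t $ 1 = 1" if "t \<in> {-\<delta><..<\<delta>}" for t
    using d(5) that revolution_LD by blast
  have diff: "c differentiable (at t)" if "t \<in> {-\<delta><..<\<delta>}" for t
    using d(3) that by (rule smooth_on_imp_differentiable)
  have der: "((\<lambda>t. c t $ i) has_real_derivative vector_derivative c (at t) $ i) (at t)"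
    if "t \<in> {-\<delta><..<\<delta>}" for t i
  proof -
    have "(c has_derivative (\<lambda>x. x *\<^sub>R vector_derivative c (at t))) (at t)"
      using diff[OF that] by (simp add: vector_derivative_works has_vector_derivative_def)
    from has_derivative_vec_nth[OF this] show ?thesis
      by (simp add: has_real_derivative_iff_has_vector_derivative has_vector_derivative_def)
  qed
  have "vector_derivative c (at t) $ 1 = 0" if "t \<in> {-\<delta><..<\<delta>}" for t
  proof -
    have "((\<lambda>t. c t $ 1) has_real_derivative 0) (at t)"
      by (rule has_field_derivative_transform_within_open[of "\<lambda>_. 1" _ _ "{-\<delta><..<\<delta>}"])
        (use that c1 in auto)
    then show ?thesis
      using der[OF that] DERIV_unique by blast
  qed
  then have "vector_derivative c (at t) $ 2 \<noteq> 0" if "t \<in> {-\<delta><..<\<delta>}" for t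
    using that d(4) by (auto simp: vec_2_nonzero_iff)
  then show ?thesis
    using d(1,2) c1 diff der by (intro that[of \<delta>]) (simp_all add: vec_eq_iff forall_2)
qed


section \<open>The torsion for arbitrary curves and null fields\<close>

text \<open>Let \<open>c(t) = (1, \<tau>(t))\<close> and let the null field be \<open>\<nu>(t) \<partial>\<^sub>u\<close> at \<open>c(t)\<close>. By
  uniqueness \<open>N = n(\<tau>) / \<nu>\<close>, so that \<open>\<langle>L, N'\<rangle> = \<tau>' \<langle>f\<^sub>u, n'\<rangle> - \<nu>' / \<nu>\<close>. The
  derivative of \<open>u\<^sup>2 - u\<^sup>4\<close> at \<open>1\<close> is \<open>-2\<close>, whence \<open>\<beta> = - 2 \<nu>\<^sup>3\<close> and
  \<open>\<beta>' / (3 \<beta>) = \<nu>' / \<nu>\<close>: the dependence on the null field cancels. Division by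
  \<open>|\<tau>'|\<close>, the length of the velocity, leaves only the sign of \<open>\<tau>'\<close>.\<close>

lemma revolution_torsion:
  assumes c: "characteristic_curve half_plane h (pt 1 0) c"
    and \<eta>: "null_vector_field half_plane h (pt 1 0) \<eta>"
    and n_null: "\<And>s. lorentz (n s) (n s) = 0"
    and n_e: "\<And>s. lorentz (n s) (df h (pt 1 s) (axis 2 1)) = 0"
    and n_l: "\<And>s. lorentz (n s) (df h (pt 1 s) (axis 1 1)) = 1"
    and n': "(n has_vector_derivative n') (at 0)"
  shows "\<bar>torsion_expr h c \<eta>\<bar> = \<bar>lorentz (df h (pt 1 0) (axis 1 1)) n'\<bar>"
proof -
  define l where "l s = df h (pt 1 s) (axis 1 1)" for s
  define e where "e s = df h (pt 1 s) (axis 2 1)" for s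
  define \<tau> where "\<tau> t = c t $ 2" for t
  define \<tau>' where "\<tau>' t = vector_derivative c (at t) $ 2" for t
  define \<nu> where "\<nu> t = \<eta> (c t) $ 1" for t
  obtain \<delta>0 where \<delta>0: "\<delta>0 > 0" "c 0 = pt 1 0"
    "\<And>t. t \<in> {-\<delta>0<..<\<delta>0} \<Longrightarrow> c t = pt 1 (\<tau> t)"
    "\<And>t. t \<in> {-\<delta>0<..<\<delta>0} \<Longrightarrow> c differentiable (at t)"
    "\<And>t. t \<in> {-\<delta>0<..<\<delta>0} \<Longrightarrow> (\<tau> has_real_derivative \<tau>' t) (at t)"
    "\<And>t. t \<in> {-\<delta>0<..<\<delta>0} \<Longrightarrow> \<tau>' t \<noteq> 0"
    using characteristic_curve_on_line[OF c] unfolding \<tau>_def \<tau>'_def by metis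
  obtain V where V: "open V" "pt 1 0 \<in> V" "V \<subseteq> half_plane" "smooth_on V \<eta>"
    "\<And>q. q \<in> LD half_plane h \<inter> V \<Longrightarrow> \<eta> q \<noteq> 0 \<and> (\<forall>w. fff h q (\<eta> q) w = 0)"
    using \<eta> unfolding null_vector_field_def by blast
  have "c differentiable (at 0)"
    using \<delta>0(1,4) by simp
  then have "c \<midarrow>0\<rightarrow> c 0"
    using differentiable_imp_continuous_within continuous_within by blast
  then have "\<forall>\<^sub>F t in at 0. c t \<in> V"
    using V(1,2) \<delta>0(2) by (intro topological_tendstoD) auto
  then obtain \<delta>1 where "\<delta>1 > 0" "\<And>t. t \<noteq> 0 \<Longrightarrow> dist t 0 < \<delta>1 \<Longrightarrow> c t \<in> V"
    by (auto simp: eventually_at)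
  then have \<delta>1: "\<delta>1 > 0" "\<And>t. dist t 0 < \<delta>1 \<Longrightarrow> c t \<in> V"
    using V(2) \<delta>0(2) by metis+
  \<comment> \<open>on \<open>S\<close> the curve runs in the line, and in the domain of the null field\<close>
  define S where "S = {- min \<delta>0 \<delta>1 <..< min \<delta>0 \<delta>1}"
  have S: "open S" "0 \<in> S"
    using \<delta>0(1) \<delta>1(1) by (auto simp: S_def)
  have sub: "t \<in> {-\<delta>0<..<\<delta>0}" "c t \<in> V" if "t \<in> S" for t
    using that \<delta>1(2)[of t] by (auto simp: S_def dist_real_def)
  have ct: "c t = pt 1 (\<tau> t)" "(\<tau> has_real_derivative \<tau>' t) (at t)" "\<tau>' t \<noteq> 0" if "t \<in> S" for t
    using sub[OF that] \<delta>0 by auto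
  have \<tau>0: "\<tau> 0 = 0"
    by (simp add: \<tau>_def \<delta>0(2))
  have \<eta>ct: "\<eta> (c t) $ 2 = 0" "\<nu> t \<noteq> 0" if "t \<in> S" for t
  proof -
    have "c t \<in> LD half_plane h \<inter> V"
      using ct(1)[OF that] sub[OF that] by (simp add: revolution_LD)
    then show "\<eta> (c t) $ 2 = 0" "\<nu> t \<noteq> 0"
      using V(5)[of "c t"] revolution_null_iff[of "c t" "\<eta> (c t)"] ct(1)[OF that]
      by (auto simp: \<nu>_def vec_2_nonzero_iff)
  qed
  have \<eta>_eq: "\<eta> (c t) = \<nu> t *\<^sub>R axis 1 1" if "t \<in> S" for t
    using \<eta>ct(1)[OF that] by (simp add: vec_eq_iff forall_2 \<nu>_def)
  obtain \<nu>' where \<nu>': "(\<nu> has_real_derivative \<nu>') (at 0)"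
  proof -
    have "\<eta> differentiable (at (c 0))"
      using V \<delta>0(2) smooth_on_imp_differentiable by metis
    then have "(\<eta> \<circ> c) differentiable (at 0)"
      using \<delta>0(1,4) by (intro differentiable_chain_at) auto
    then obtain D where "((\<eta> \<circ> c) has_derivative D) (at 0)"
      by (auto simp: differentiable_def)
    from has_derivative_vec_nth[OF this, of 1] have "\<nu> differentiable (at 0)"
      by (auto simp: differentiable_def \<nu>_def[abs_def] o_def)
    then show ?thesis
      using that real_differentiable_def by blast
  qed
  have gram: "lorentz (e s) (e s) = 1" "lorentz (e s) (l s) = 0" "lorentz (l s) (l s) = 0" for s
    using revolution_fff[of "pt 1 s" "axis 2 1" "axis 2 1"]
      revolution_fff[of "pt 1 s" "axis 2 1" "axis 1 1"]
      revolution_fff[of "pt 1 s" "axis 1 1" "axis 1 1"]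
    by (simp_all add: fff_def e_def l_def)
  have frame: "lorentz (e s) (e s) = 1" "lorentz (e s) (l s) = 0" "lorentz (l s) (l s) = 0"
    "lorentz (e s) (n s) = 0" "lorentz (l s) (n s) = 1" for s
    using gram n_e n_l lorentz_commute unfolding e_def l_def by metis+
  have chat: "chat_deriv h c t = \<tau>' t *\<^sub>R e (\<tau> t)" if "t \<in> S" for t
    using chat_deriv_along_line[OF ct(2)[OF that] S(1) that ct(1)] ct(1)[OF that]
    by (simp add: e_def)
  have len: "lnorm (chat_deriv h c t) = \<bar>\<tau>' t\<bar>" if "t \<in> S" for t
    using chat[OF that] lnorm_along_line by (simp add: e_def)
  have L: "L_field h c \<eta> t = \<nu> t *\<^sub>R l (\<tau> t)" if "t \<in> S" for t
    using revolution_differentiable[of "c t"] linear_frechet_derivative[of h "at (c t)"] ct(1)[OF that]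
    unfolding L_field_def \<eta>_eq[OF that] by (simp add: l_def linear_scale)
  have N: "N_field h c \<eta> t = (1 / \<nu> t) *\<^sub>R n (\<tau> t)" if "t \<in> S" for t
    unfolding N_field_def
  proof (rule the_equality)
    let ?n = "(1 / \<nu> t) *\<^sub>R n (\<tau> t)"
    show "lorentz ?n ?n = 0 \<and> lorentz ?n (e_field h c t) = 0 \<and> lorentz ?n (L_field h c \<eta> t) = 1"
      using n_null n_e n_l \<eta>ct(2)[OF that]
      by (simp add: lorentz_bilinear e_field_def chat[OF that] L[OF that] e_def l_def)
    fix m
    assume m: "lorentz m m = 0 \<and> lorentz m (e_field h c t) = 0 \<and> lorentz m (L_field h c \<eta> t) = 1"
    have "lorentz m (e (\<tau> t)) = 0"
      using m ct(3)[OF that] len[OF that] by (simp add: e_field_def chat[OF that] lorentz_bilinear)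
    moreover have "\<nu> t * lorentz m (l (\<tau> t)) = 1"
      using m by (simp add: L[OF that] lorentz_bilinear)
    ultimately have "\<nu> t *\<^sub>R m = n (\<tau> t)"
      using m n_null frame by (intro lorentz_null_transversal_unique[of "e (\<tau> t)" "l (\<tau> t)"])
        (simp_all add: lorentz_bilinear)
    then show "m = ?n"
      using \<eta>ct(2)[OF that] by (simp flip: \<open>\<nu> t *\<^sub>R m = n (\<tau> t)\<close>)
  qed
  have nv: "\<nu> 0 \<noteq> 0" and inv: "((\<lambda>t. 1 / \<nu> t) has_real_derivative - \<nu>' / (\<nu> 0)\<^sup>2) (at 0)"
    using \<eta>ct(2)[OF S(2)] \<nu>' by (auto intro!: derivative_eq_intros simp: power2_eq_square)
  have "((n \<circ> \<tau>) has_vector_derivative \<tau>' 0 *\<^sub>R n') (at 0)"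
    using vector_diff_chain_at[of \<tau> "\<tau>' 0" 0 n n'] ct(2)[OF S(2)] n' \<tau>0
    by (simp add: has_real_derivative_iff_has_vector_derivative)
  from has_vector_derivative_scaleR[OF inv this]
  have "((\<lambda>t. (1 / \<nu> t) *\<^sub>R n (\<tau> t)) has_vector_derivative
      ((\<tau>' 0 / \<nu> 0) *\<^sub>R n' + (- \<nu>' / (\<nu> 0)\<^sup>2) *\<^sub>R n 0)) (at 0)"
    by (simp add: \<tau>0)
  then have "(N_field h c \<eta> has_vector_derivative
      ((\<tau>' 0 / \<nu> 0) *\<^sub>R n' + (- \<nu>' / (\<nu> 0)\<^sup>2) *\<^sub>R n 0)) (at 0)"
    by (rule has_vector_derivative_transform_within_open[OF _ S]) (simp add: N)
  then have N': "vector_derivative (N_field h c \<eta>) (at 0) =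
      (\<tau>' 0 / \<nu> 0) *\<^sub>R n' + (- \<nu>' / (\<nu> 0)\<^sup>2) *\<^sub>R n 0"
    by (rule vector_derivative_at)
  have LN: "lorentz (L_field h c \<eta> 0) (vector_derivative (N_field h c \<eta>) (at 0)) =
      \<tau>' 0 * lorentz (l 0) n' - \<nu>' / \<nu> 0"
    using nv frame(5)[of 0]
    by (simp add: L[OF S(2)] N' lorentz_bilinear \<tau>0 field_simps power2_eq_square)
  have \<beta>: "\<beta>_fun h c \<eta> t = - 2 * \<nu> t ^ 3" if "t \<in> S" for t
  proof -
    have "\<eta> differentiable (at (c t))"
      using V(4) sub(2)[OF that] smooth_on_imp_differentiable by blast
    then obtain D where D: "(\<eta> has_derivative D) (at (c t))"
      by (auto simp: differentiable_def)
    \<comment> \<open>the terms with derivatives of \<open>\<eta>\<close> vanish: at \<open>c t\<close> both the coefficient of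
      \<open>du\<^sup>2\<close> and the second component of \<open>\<eta>\<close> are \<open>0\<close>\<close>
    have "((\<lambda>q. ((q $ 1)\<^sup>2 - (q $ 1)^4) * (\<eta> q $ 1 * \<eta> q $ 1) + (q $ 1)\<^sup>2 * (\<eta> q $ 2 * \<eta> q $ 2))
        has_derivative (\<lambda>w. - 2 * w $ 1 * (\<nu> t)\<^sup>2)) (at (c t))"
      using \<eta>ct(1)[OF that] ct(1)[OF that]
      by (auto intro!: derivative_eq_intros D[unfolded ct(1)[OF that]] simp: \<nu>_def power2_eq_square)
    then have "((\<lambda>q. fff h q (\<eta> q) (\<eta> q)) has_derivative (\<lambda>w. - 2 * w $ 1 * (\<nu> t)\<^sup>2)) (at (c t))"
      by (rule has_derivative_transform_within_open[OF _ V(1) sub(2)[OF that]])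
        (use V(3) in \<open>auto simp: revolution_fff\<close>)
    then show ?thesis
      unfolding \<beta>_fun_def by (simp add: frechet_derivative_at[symmetric] \<nu>_def power2_eq_square power3_eq_cube)
  qed
  have "((\<lambda>t. - 2 * \<nu> t ^ 3) has_real_derivative - 6 * (\<nu> 0)\<^sup>2 * \<nu>') (at 0)"
    by (auto intro!: derivative_eq_intros \<nu>')
  then have "(\<beta>_fun h c \<eta> has_real_derivative - 6 * (\<nu> 0)\<^sup>2 * \<nu>') (at 0)"
    by (rule has_field_derivative_transform_within_open[OF _ S]) (simp add: \<beta>)
  then have "deriv (\<beta>_fun h c \<eta>) 0 / (3 * \<beta>_fun h c \<eta> 0) = \<nu>' / \<nu> 0"
    using nv by (simp add: DERIV_imp_deriv \<beta>[OF S(2)] field_simps power2_eq_square power3_eq_cube)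
  then have "torsion_expr h c \<eta> = \<tau>' 0 * lorentz (l 0) n' / \<bar>\<tau>' 0\<bar>"
    by (simp add: torsion_expr_def LN len[OF S(2)])
  then show ?thesis
    using ct(3)[OF S(2)] by (simp add: l_def abs_mult)
qed

end

section \<open>Two isometric surfaces\<close>

text \<open>The orbits of the profile \<open>(u, 0, u\<^sup>5/10 - u\<^sup>3/6)\<close>. The metric of an orbit surface with
  profile \<open>(u, 0, b(u))\<close> is \<open>u\<^sup>2 dt\<^sup>2 - 2 b' du\<^sup>2\<close>.\<close>

definition rotational :: "real^2 \<Rightarrow> real^3" where
  "rotational q = null_vec (q $ 1) (q $ 2 * q $ 1)
     ((q $ 1)^5 / 10 - (q $ 1)^3 / 6 + (q $ 2)\<^sup>2 * q $ 1 / 2)"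

text \<open>The orbits of the profile \<open>(0, - u\<^sup>2/2, B(u))\<close> under the screw motion, with orbit
  parameter \<open>s\<close>, have the metric \<open>u\<^sup>2 ds\<^sup>2 - 2 B' du ds + u\<^sup>2 du\<^sup>2\<close>. Completing the square
  requires \<open>ds - (B' / u\<^sup>2) du\<close> to be \<open>dt\<close>, and leaves \<open>(u\<^sup>2 - B'\<^sup>2 / u\<^sup>2) du\<^sup>2\<close>; with
  \<open>B = u\<^sup>4/4\<close> these are \<open>s = t + u\<^sup>2/2\<close> and \<open>u\<^sup>2 - u\<^sup>4\<close>.\<close>

definition screw :: "real^2 \<Rightarrow> real^3" where
  "screw q = (let u = q $ 1; s = q $ 2 + u\<^sup>2 / 2
     in null_vec s (s\<^sup>2 / 2 - u\<^sup>2 / 2) (u^4 / 4 - u\<^sup>2 * s / 2 + s^3 / 6))"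

lemma df_rotational:
  "df rotational q w =
     null_vec (w $ 1) (q $ 2 * w $ 1 + q $ 1 * w $ 2)
       (((q $ 1)^4 / 2 - (q $ 1)\<^sup>2 / 2 + (q $ 2)\<^sup>2 / 2) * w $ 1 + q $ 1 * q $ 2 * w $ 2)"
proof -
  have "(rotational has_derivative (\<lambda>w. null_vec (w $ 1) (q $ 2 * w $ 1 + q $ 1 * w $ 2)
       (((q $ 1)^4 / 2 - (q $ 1)\<^sup>2 / 2 + (q $ 2)\<^sup>2 / 2) * w $ 1 + q $ 1 * q $ 2 * w $ 2))) (at q)"
    unfolding rotational_def[abs_def]
    by (rule has_derivative_null_vec)
      (auto intro!: derivative_eq_intros simp: field_simps)
  then show ?thesis
    by (simp flip: frechet_derivative_at)
qed

lemma df_screw: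
  fixes q w :: "real^2"
  defines "u \<equiv> q $ 1" and "s \<equiv> q $ 2 + (q $ 1)\<^sup>2 / 2" and "r \<equiv> w $ 2 + q $ 1 * w $ 1"
  shows "df screw q w =
    null_vec r (s * r - u * w $ 1) ((u^3 - u * s) * w $ 1 + (s\<^sup>2 / 2 - u\<^sup>2 / 2) * r)"
proof -
  have "(screw has_derivative (\<lambda>w. null_vec (w $ 2 + u * w $ 1)
      (s * (w $ 2 + u * w $ 1) - u * w $ 1)
      ((u^3 - u * s) * w $ 1 + (s\<^sup>2 / 2 - u\<^sup>2 / 2) * (w $ 2 + u * w $ 1)))) (at q)"
    unfolding screw_def[abs_def] Let_def u_def s_def
    by (rule has_derivative_null_vec)
      (auto intro!: derivative_eq_intros simp: field_simps power2_eq_square power3_eq_cube)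
  then show ?thesis
    by (simp add: r_def u_def flip: frechet_derivative_at)
qed

lemma real_polynomial_vec_nth: "real_polynomial_function (\<lambda>x. x $ i)"
  by (rule real_polynomial_function.intros(1)) (rule bounded_linear_vec_nth)

lemmas polynomial_intros =
  polynomial_function_null_vec real_polynomial_vec_nth real_polynomial_function.intros(2-4)
  real_polynomial_function_diff real_polynomial_function_divide real_polynomial_function_power

lemma polynomial_rotational: "polynomial_function rotational"
  unfolding rotational_def[abs_def] by (intro polynomial_intros)

lemma polynomial_screw: "polynomial_function screw"
  unfolding screw_def[abs_def] Let_def by (intro polynomial_intros)

lemma revolution_metric_rotational: "revolution_metric rotational"
  unfolding revolution_metric_def
proof (intro ballI conjI allI)
  show "rotational differentiable (at q)" for q
    by (rule polynomial_function_derivative[OF polynomial_rotational])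
  show "fff rotational q v w =
      ((q $ 1)\<^sup>2 - (q $ 1)^4) * (v $ 1 * w $ 1) + (q $ 1)\<^sup>2 * (v $ 2 * w $ 2)" for q v w
    unfolding fff_def df_rotational lorentz_null_vec
    by (simp add: field_simps power2_eq_square power4_eq_xxxx)
qed

lemma revolution_metric_screw: "revolution_metric screw"
  unfolding revolution_metric_def
proof (intro ballI conjI allI)
  show "screw differentiable (at q)" for q
    by (rule polynomial_function_derivative[OF polynomial_screw])
  show "fff screw q v w =
      ((q $ 1)\<^sup>2 - (q $ 1)^4) * (v $ 1 * w $ 1) + (q $ 1)\<^sup>2 * (v $ 2 * w $ 2)" for q v w
    unfolding fff_def df_screw lorentz_null_vec
    by (simp add: field_simps power2_eq_square power3_eq_cube power4_eq_xxxx)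
qed

text \<open>A continuous left inverse on the image makes the parametrisation an embedding.\<close>

lemma surface_half_planeI:
  fixes h :: "real^2 \<Rightarrow> real^3" and k :: "real^3 \<Rightarrow> real^2"
  assumes "polynomial_function h"
    and "\<And>q w. q \<in> half_plane \<Longrightarrow> df h q w = 0 \<Longrightarrow> w = 0"
    and "continuous_on (h ` half_plane) k" and "\<And>q. q \<in> half_plane \<Longrightarrow> k (h q) = q"
  shows "surface half_plane h"
  unfolding surface_def
proof (intro conjI ballI exI)
  show "open half_plane" "connected half_plane"
    by (rule open_half_plane connected_half_plane)+
  have "pt 1 0 \<in> half_plane"
    by simp
  then show "half_plane \<noteq> {}"
    by blast
  show "smooth_on half_plane h"
    using assms(1) by (rule smooth_on_polynomial_function)
  show "inj (df h q)" if "q \<in> half_plane" for q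
  proof -
    have "linear (df h q)"
      by (rule linear_frechet_derivative) (rule polynomial_function_derivative[OF assms(1)])
    then show ?thesis
      using assms(2)[OF that] by (simp add: linear_injective_0)
  qed
  show "homeomorphism half_plane (h ` half_plane) h k"
    using assms(3,4)
    by (auto intro!: homeomorphismI continuous_on_polymonial_function assms(1))
qed

lemma null_vec_eq_0: "null_vec a y b = 0 \<longleftrightarrow> a = 0 \<and> y = 0 \<and> b = 0"
  by (auto simp: vec_eq_iff forall_3)

lemma surface_rotational: "surface half_plane rotational"
proof (rule surface_half_planeI[OF polynomial_rotational])
  \<comment> \<open>the parameters are \<open>u = a\<close> and \<open>t = y / a\<close>\<close>
  let ?k = "\<lambda>x::real^3. pt (x $ 2 + x $ 3) (x $ 1 / (x $ 2 + x $ 3))"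
  show "continuous_on (rotational ` half_plane) ?k"
    unfolding pt_def by (intro continuous_intros) (auto simp: rotational_def half_plane_def)
  show "?k (rotational q) = q" if "q \<in> half_plane" for q
    using that by (simp add: rotational_def half_plane_def vec_eq_iff forall_2)
  show "w = 0" if "q \<in> half_plane" "df rotational q w = 0" for q w
  proof -
    have "w $ 1 = 0" "q $ 2 * w $ 1 + q $ 1 * w $ 2 = 0"
      using that(2) unfolding df_rotational null_vec_eq_0 by auto
    then show ?thesis
      using that(1) by (simp add: half_plane_def vec_eq_iff forall_2)
  qed
qed

lemma surface_screw: "surface half_plane screw"
proof (rule surface_half_planeI[OF polynomial_screw])
  \<comment> \<open>\<open>s = a\<close>, and \<open>y = (s\<^sup>2 - u\<^sup>2) / 2\<close> determines \<open>u > 0\<close>\<close>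
  let ?k = "\<lambda>x::real^3. let s = x $ 2 + x $ 3; u = sqrt (s\<^sup>2 - 2 * x $ 1) in pt u (s - u\<^sup>2 / 2)"
  show "continuous_on (screw ` half_plane) ?k"
    unfolding pt_def Let_def by (intro continuous_intros) auto
  show "?k (screw q) = q" if "q \<in> half_plane" for q
    using that by (simp add: screw_def Let_def half_plane_def vec_eq_iff forall_2)
  show "w = 0" if "q \<in> half_plane" "df screw q w = 0" for q w
  proof -
    have "w $ 2 + q $ 1 * w $ 1 = 0" "q $ 1 * w $ 1 = 0"
      using that(2) unfolding df_screw null_vec_eq_0 by auto
    then show ?thesis
      using that(1) by (simp add: half_plane_def vec_eq_iff forall_2)
  qed
qed


section \<open>Comparison of the torsions\<close>

lemma has_torsion_half_plane:
  assumes "revolution_metric h"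
  shows "\<exists>\<kappa>. has_lightlike_geodesic_torsion half_plane h (pt 1 0) \<kappa>"
  using assms revolution_first_kind characteristic_line null_field_coordinate
  unfolding has_lightlike_geodesic_torsion_def by blast

lemma torsion_rotational:
  assumes "has_lightlike_geodesic_torsion half_plane rotational (pt 1 0) \<kappa>"
  shows "\<kappa> = 0"
proof -
  obtain c \<eta> where c: "characteristic_curve half_plane rotational (pt 1 0) c"
    and \<eta>: "null_vector_field half_plane rotational (pt 1 0) \<eta>" and \<kappa>: "\<kappa> = torsion_expr rotational c \<eta>"
    using assms unfolding has_lightlike_geodesic_torsion_def by blast
  \<comment> \<open>the direction of the axis of rotation\<close>
  let ?n = "\<lambda>s::real. null_vec 0 0 (- 1)"
  have "\<bar>torsion_expr rotational c \<eta>\<bar> = \<bar>lorentz (df rotational (pt 1 0) (axis 1 1)) 0\<bar>"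
    by (rule revolution_torsion[OF revolution_metric_rotational c \<eta>, of ?n])
      (simp_all add: df_rotational)
  then show ?thesis
    by (simp add: \<kappa> lorentz_def)
qed

lemma torsion_screw:
  assumes "has_lightlike_geodesic_torsion half_plane screw (pt 1 0) \<kappa>"
  shows "\<bar>\<kappa>\<bar> = 1"
proof -
  obtain c \<eta> where c: "characteristic_curve half_plane screw (pt 1 0) c"
    and \<eta>: "null_vector_field half_plane screw (pt 1 0) \<eta>" and \<kappa>: "\<kappa> = torsion_expr screw c \<eta>"
    using assms unfolding has_lightlike_geodesic_torsion_def by blast
  \<comment> \<open>At \<open>u = 1\<close> one has \<open>s = t + 1/2\<close>. The product of \<open>f\<^sub>t\<close> with the null vector
    \<open>(1, r, r\<^sup>2/2)\<close> is \<open>(1 - (r - s)\<^sup>2) / 2\<close>, which vanishes for \<open>r = s - 1\<close>, which gives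
    \<open>f\<^sub>u\<close>, and for \<open>r = s + 1\<close>. The product of these two null vectors is \<open>-2\<close>, so the second
    one is multiplied by \<open>-1/2\<close>.\<close>
  let ?n = "\<lambda>t::real. null_vec (- 1 / 2) (- (t + 3 / 2) / 2) (- (t + 3 / 2)\<^sup>2 / 4)"
  have "(?n has_derivative (\<lambda>x. null_vec 0 (- x / 2) (- 3 / 4 * x))) (at 0)"
    by (rule has_derivative_null_vec) (auto intro!: derivative_eq_intros simp: field_simps)
  then have "(?n has_vector_derivative null_vec 0 (- 1 / 2) (- 3 / 4)) (at 0)"
    by (simp add: has_vector_derivative_def null_vec_linear mult.commute)
  then have "\<bar>torsion_expr screw c \<eta>\<bar> =
      \<bar>lorentz (df screw (pt 1 0) (axis 1 1)) (null_vec 0 (- 1 / 2) (- 3 / 4))\<bar>"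
    by (intro revolution_torsion[OF revolution_metric_screw c \<eta>, of ?n])
      (simp_all add: df_screw field_simps power2_eq_square)
  then show ?thesis
    by (simp add: \<kappa> df_screw)
qed

theorem corollary6p7:
  shows "\<exists>(U :: (real^2) set) (f :: real^2 \<Rightarrow> real^3) (g :: real^2 \<Rightarrow> real^3).
           mixed_type_surface U f \<and> mixed_type_surface U g \<and> same_fff U f g \<and>
           (\<exists>p\<in>U. first_kind U f p \<and> first_kind U g p \<and>
                  lightlike_geodesic_torsions_differ_at U f g p)"
proof (intro exI conjI bexI)
  note metrics = revolution_metric_rotational revolution_metric_screw
  show "mixed_type_surface half_plane rotational" "mixed_type_surface half_plane screw"
    using revolution_mixed_type metrics surface_rotational surface_screw by blast+
  show "same_fff half_plane rotational screw"
    by (simp add: same_fff_def revolution_fff metrics)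
  show "first_kind half_plane rotational (pt 1 0)" "first_kind half_plane screw (pt 1 0)"
    using revolution_first_kind metrics by blast+
  show "lightlike_geodesic_torsions_differ_at half_plane rotational screw (pt 1 0)"
    unfolding lightlike_geodesic_torsions_differ_at_def
    using has_torsion_half_plane metrics torsion_rotational torsion_screw by fastforce
  show "pt 1 0 \<in> half_plane"
    by simp
qed

end
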